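(* Let $X$ and $Y$ be two rearrangement invariant sequence spaces with the Fatou property. Further, let $\varphi$ be a positive, increasing and concave function on $(0,\infty)$. Then (i) $M(m_\varphi,Y)=[Y(1/\varphi)]^{\bigstar}$ provided $\gamma_\varphi>1$; (ii) $M(X,\lambda_\varphi)=[X^\times(\varphi(t)/t)]^{\bigstar}$ provided $\delta_\varphi<\infty$.
   Context: A Köthe sequence space is a Banach space $X$ that is a linear subspace of the space of all sequences, with $|x|\le|y|$ and $y\in X$ implying $x\in X$, $\|x\|_X\le\|y\|_X$, and containing all finitely supported sequences. It is rearrangement invariant if $x$ equi-measurable (w.r.t. counting measure) with $y\in X$ implies $x\in X$, $\|x\|_X=\|y\|_X$. Fatou property: the closed unit ball is closed under coordinatewise convergence. $M(X,Y)=\{g:fg\in Y\ \forall f\in X\}$ with norm $\sup_{\|f\|_X\le1}\|fg\|_Y$; $X^\times=M(X,\ell_1)$ is the Köthe dual. For a positive weight $w$ (functions on $(0,\infty)$ are restricted to $\mathbb N$), $X(w)=\{x:xw\in X\}$ with $\|x\|_{X(w)}=\|xw\|_X$. The symmetrization of $X$ is $X^{\bigstar}=\{x:x^\star\in X\}$ with $\|x\|_{X^{\bigstar}}=\|x^\star\|_X$, where $x^\star$ is the decreasing rearrangement of $|x|$. Equality "$=$" of spaces means equality as sets with equivalent (quasi-)norms. Lorentz sequence space $\lambda_\varphi$: $\|x\|_{\lambda_\varphi}=\sum_{n=1}^\infty x_n^\star(\varphi(n+1)-\varphi(n))<\infty$. Marcinkiewicz sequence space $m_\varphi$: $\|x\|_{m_\varphi}=\sup_n\frac{\varphi(n)}n\sum_{k=1}^nx_k^\star<\infty$.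 With $\overline\varphi(s)=\sup_{t>0}\varphi(st)/\varphi(t)$, $\gamma_\varphi=\lim_{s\to\infty}\frac{\log s}{\log\overline\varphi(s)}$ and $\delta_\varphi=\lim_{s\to0^+}\frac{\log s}{\log\overline\varphi(s)}$ (values in $[1,\infty]$). *)

theory Defs
  imports "HOL-Analysis.Analysis"
begin

text \<open>
  Sequences are real and indexed by the positive integers. A sequence is encoded as a function
  \<^typ>\<open>nat \<Rightarrow> real\<close> whose value at \<open>n\<close> is the term with index \<open>n + 1\<close>; accordingly the restriction of a
  function on the positive half-line to the positive integers is evaluated at \<open>real (Suc n)\<close>.
\<close>

text \<open>
  A sequence space consists of its set of elements and its (quasi-)norm, so that one set can carry
  several norms. Values of \<open>snorm\<close> outside \<open>elems\<close> are irrelevant.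
\<close>

record seq_space =
  elems :: "(nat \<Rightarrow> real) set"
  snorm :: "(nat \<Rightarrow> real) \<Rightarrow> real"

definition banach_seq_space :: "seq_space \<Rightarrow> bool" where
  "banach_seq_space X \<longleftrightarrow>
     (\<lambda>_. 0) \<in> elems X \<and>
     (\<forall>x\<in>elems X. \<forall>y\<in>elems X. (\<lambda>n. x n + y n) \<in> elems X) \<and>
     (\<forall>c. \<forall>x\<in>elems X. (\<lambda>n. c * x n) \<in> elems X) \<and>
     (\<forall>x\<in>elems X. 0 \<le> snorm X x \<and> (snorm X x = 0 \<longleftrightarrow> x = (\<lambda>_. 0))) \<and>
     (\<forall>c. \<forall>x\<in>elems X. snorm X (\<lambda>n. c * x n) = \<bar>c\<bar> * snorm X x) \<and>
     (\<forall>x\<in>elems X. \<forall>y\<in>elems X. snorm X (\<lambda>n. x n + y n) \<le> snorm X x + snorm X y) \<and>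
     (\<forall>u. (\<forall>i. u i \<in> elems X) \<and>
          (\<forall>e>0. \<exists>N. \<forall>i\<ge>N. \<forall>j\<ge>N. snorm X (\<lambda>n. u i n - u j n) < e) \<longrightarrow>
          (\<exists>x\<in>elems X. (\<lambda>i. snorm X (\<lambda>n. u i n - x n)) \<longlonglongrightarrow> 0))"

definition koethe_space :: "seq_space \<Rightarrow> bool" where
  "koethe_space X \<longleftrightarrow>
     banach_seq_space X \<and>
     (\<forall>x. \<forall>y\<in>elems X. (\<forall>n. \<bar>x n\<bar> \<le> \<bar>y n\<bar>) \<longrightarrow> x \<in> elems X \<and> snorm X x \<le> snorm X y) \<and>
     (\<forall>x. finite {n. x n \<noteq> 0} \<longrightarrow> x \<in> elems X)"

definition distr_fun :: "(nat \<Rightarrow> real) \<Rightarrow> real \<Rightarrow> ennreal" where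
  "distr_fun x l = emeasure (count_space UNIV) {n. l < \<bar>x n\<bar>}"

definition equimeasurable :: "(nat \<Rightarrow> real) \<Rightarrow> (nat \<Rightarrow> real) \<Rightarrow> bool" where
  "equimeasurable x y \<longleftrightarrow> (\<forall>l\<ge>0. distr_fun x l = distr_fun y l)"

definition rearrangement_invariant :: "seq_space \<Rightarrow> bool" where
  "rearrangement_invariant X \<longleftrightarrow>
     koethe_space X \<and>
     (\<forall>x. \<forall>y\<in>elems X. equimeasurable x y \<longrightarrow> x \<in> elems X \<and> snorm X x = snorm X y)"

definition fatou_property :: "seq_space \<Rightarrow> bool" where
  "fatou_property X \<longleftrightarrow>
     (\<forall>u x. (\<forall>i. u i \<in> elems X \<and> snorm X (u i) \<le> 1) \<and> (\<forall>n. (\<lambda>i. u i n) \<longlonglongrightarrow> x n) \<longrightarrow>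
            x \<in> elems X \<and> snorm X x \<le> 1)"

text \<open>
  The decreasing rearrangement of \<open>\<bar>x\<bar>\<close>. It is finite exactly when \<open>x\<close> is bounded; for unbounded \<open>x\<close>
  the set below is empty and the value is meaningless. Therefore every space defined through
  rearrangements explicitly requires boundedness, excluding the sequences whose rearrangement is infinite.
\<close>

definition rearr :: "(nat \<Rightarrow> real) \<Rightarrow> nat \<Rightarrow> real" where
  "rearr x n = Inf {l. 0 \<le> l \<and> distr_fun x l \<le> of_nat n}"

text \<open>
  For Koethe spaces \<open>X\<close>, \<open>Y\<close> (which are complete) the supremum in the multiplier norm is finite by the closed
  graph theorem.
\<close>

definition multipliers :: "seq_space \<Rightarrow> seq_space \<Rightarrow> seq_space" where
  "multipliers X Y =
     \<lparr>elems = {g. \<forall>f\<in>elems X. (\<lambda>n. f n * g n) \<in> elems Y},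
      snorm = (\<lambda>g. SUP f\<in>{f \<in> elems X. snorm X f \<le> 1}. snorm Y (\<lambda>n. f n * g n))\<rparr>"

definition ell1 :: seq_space where
  "ell1 = \<lparr>elems = {x. summable (\<lambda>n. \<bar>x n\<bar>)}, snorm = (\<lambda>x. \<Sum>n. \<bar>x n\<bar>)\<rparr>"

definition koethe_dual :: "seq_space \<Rightarrow> seq_space" where
  "koethe_dual X = multipliers X ell1"

definition weighted :: "seq_space \<Rightarrow> (real \<Rightarrow> real) \<Rightarrow> seq_space" where
  "weighted X w =
     \<lparr>elems = {x. (\<lambda>n. x n * w (real (Suc n))) \<in> elems X},
      snorm = (\<lambda>x. snorm X (\<lambda>n. x n * w (real (Suc n))))\<rparr>"

definition symmetrization :: "seq_space \<Rightarrow> seq_space" where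
  "symmetrization X =
     \<lparr>elems = {x. bounded (range x) \<and> rearr x \<in> elems X},
      snorm = (\<lambda>x. snorm X (rearr x))\<rparr>"

definition lorentz :: "(real \<Rightarrow> real) \<Rightarrow> seq_space" where
  "lorentz \<phi> =
     \<lparr>elems = {x. bounded (range x) \<and>
                  summable (\<lambda>n. rearr x n * (\<phi> (real (Suc n) + 1) - \<phi> (real (Suc n))))},
      snorm = (\<lambda>x. \<Sum>n. rearr x n * (\<phi> (real (Suc n) + 1) - \<phi> (real (Suc n))))\<rparr>"

definition marcinkiewicz :: "(real \<Rightarrow> real) \<Rightarrow> seq_space" where
  "marcinkiewicz \<phi> =
     \<lparr>elems = {x. bounded (range x) \<and>
                  bdd_above (range (\<lambda>n. \<phi> (real (Suc n)) / real (Suc n) * (\<Sum>k\<le>n. rearr x k)))},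
      snorm = (\<lambda>x. SUP n. \<phi> (real (Suc n)) / real (Suc n) * (\<Sum>k\<le>n. rearr x k))\<rparr>"

definition same_space :: "seq_space \<Rightarrow> seq_space \<Rightarrow> bool" where
  "same_space A B \<longleftrightarrow>
     elems A = elems B \<and>
     (\<exists>c>0. \<exists>C>0. \<forall>x\<in>elems A. c * snorm B x \<le> snorm A x \<and> snorm A x \<le> C * snorm B x)"

text \<open>For \<open>\<phi>\<close> positive, increasing and concave, \<open>dil_sup \<phi> s\<close> lies between \<open>min 1 s\<close> and \<open>max 1 s\<close>.\<close>

definition dil_sup :: "(real \<Rightarrow> real) \<Rightarrow> real \<Rightarrow> real" where
  "dil_sup \<phi> s = (SUP t\<in>{0<..}. \<phi> (s * t) / \<phi> t)"

text \<open>
  The indices take values in \<open>[1, \<infinity>]\<close>: a quotient whose denominator is zero counts as \<open>\<infinity>\<close>. This is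
  what extended real division yields for a positive numerator, so in \<open>delta_index\<close>, where both
  logarithms are nonpositive, numerator and denominator are negated.
\<close>

definition gamma_index :: "(real \<Rightarrow> real) \<Rightarrow> ereal" where
  "gamma_index \<phi> = Lim at_top (\<lambda>s. ereal (ln s) / ereal (ln (dil_sup \<phi> s)))"

definition delta_index :: "(real \<Rightarrow> real) \<Rightarrow> ereal" where
  "delta_index \<phi> = Lim (at_right 0) (\<lambda>s. ereal (- ln s) / ereal (- ln (dil_sup \<phi> s)))"

end

theory Submission
  imports Defs
begin

text \<open>
  Both identities rest on two opposite ways of comparing a product \<open>f * g\<close> with the product of the
  rearrangements. From above, \<open>rearr (f * g) m \<le> rearr f (m div 2) * rearr g (m div 2)\<close>
  (\<open>rearr_mult_le\<close>), and halving the index costs a factor \<open>2\<close> in a rearrangement invariant norm. From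
  below, some injection \<open>s\<close> satisfies \<open>\<bar>g (s n)\<bar> \<ge> rearr g n / 2\<close> (\<open>rearr_nearly_attained\<close>); if the entries
  of a sequence \<open>f\<close> are moved along \<open>s\<close>, which changes no rearrangement invariant norm, then the product
  with \<open>g\<close> dominates a copy of \<open>f * rearr g / 2\<close>. So a multiplier \<open>g\<close> may be replaced by \<open>rearr g\<close>, tested
  against arbitrary sequences \<open>f\<close>.

  For the Marcinkiewicz space, \<open>rearr f n \<le> snorm f / \<phi> (n + 1)\<close> always holds, so \<open>1 / \<phi>\<close> dominates the
  rearrangements of the unit ball. If \<open>gamma_index \<phi> > 1\<close>, then \<open>1 / \<phi>\<close> itself belongs to the space
  (\<open>marcinkiewicz_contains_inverse\<close>), and testing on its copies alone decides whether \<open>g\<close> is a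
  multiplier.

  For the Lorentz space, \<open>delta_index \<phi> < \<infinity>\<close> makes the weight \<open>\<phi> (n + 1) - \<phi> n\<close> interchangeable with the
  larger weight \<open>\<phi> n / n\<close> on decreasing sequences (\<open>sum_weight_mean_le\<close> and summation by parts). As the new
  weight is decreasing too, the Hardy--Littlewood inequality turns the Lorentz norm of \<open>f * rearr g\<close> into
  a bound for the unrearranged sum of \<open>\<bar>f n\<bar> * rearr g n * \<phi> n / n\<close>, which is what the Koethe dual of \<open>X\<close> measures. The
  Fatou property of \<open>X\<close> enters through a gliding hump that keeps the Koethe dual norm finite
  (\<open>koethe_dual_bdd_above\<close>).

  Of the indices only one consequence is used: some dilation shrinks \<open>t / \<phi> t\<close>, respectively \<open>\<phi>\<close>, by a
  fixed factor below \<open>1\<close> at all \<open>t > 0\<close>. By \<open>sum_div_le_of_dilation_growth\<close> this controls the sums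
  of \<open>\<theta> k / k\<close> for \<open>\<theta> t = t / \<phi> t\<close> and for \<open>\<theta> = \<phi>\<close>.
\<close>

section \<open>The decreasing rearrangement\<close>

lemma distr_fun_le_iff:
  "distr_fun x l \<le> of_nat n \<longleftrightarrow> finite {k. l < \<bar>x k\<bar>} \<and> card {k. l < \<bar>x k\<bar>} \<le> n"
proof (cases "finite {k. l < \<bar>x k\<bar>}")
  case True
  then show ?thesis by (simp add: distr_fun_def emeasure_count_space)
next
  case False
  then show ?thesis
    by (simp add: distr_fun_def emeasure_count_space top_unique)
qed

lemma rearr_eq_Inf:
  "rearr x n = Inf {l. 0 \<le> l \<and> finite {k. l < \<bar>x k\<bar>} \<and> card {k. l < \<bar>x k\<bar>} \<le> n}"
  by (simp add: rearr_def distr_fun_le_iff)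

lemma rearr_le:
  assumes "0 \<le> l" "finite {k. l < \<bar>x k\<bar>}" "card {k. l < \<bar>x k\<bar>} \<le> n"
  shows "rearr x n \<le> l"
  unfolding rearr_eq_Inf using assms by (intro cInf_lower bdd_belowI[of _ 0]) auto

lemma rearr_levels_nonempty:
  fixes x :: "nat \<Rightarrow> real"
  assumes "bounded (range x)"
  shows "{l. 0 \<le> l \<and> finite {k. l < \<bar>x k\<bar>} \<and> card {k. l < \<bar>x k\<bar>} \<le> n} \<noteq> {}"
proof -
  obtain K where K: "\<And>k. \<bar>x k\<bar> \<le> K"
    using assms by (auto simp: bounded_iff)
  then have "{k. K < \<bar>x k\<bar>} = {}" "0 \<le> K"
    using order_trans[OF abs_ge_zero K[of 0]] by (auto simp: not_less)
  then have "K \<in> {l. 0 \<le> l \<and> finite {k. l < \<bar>x k\<bar>} \<and> card {k. l < \<bar>x k\<bar>} \<le> n}"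
    by simp
  then show ?thesis by blast
qed

lemma rearr_nonneg:
  assumes "bounded (range x)"
  shows "0 \<le> rearr x n"
  unfolding rearr_eq_Inf using rearr_levels_nonempty[OF assms] by (intro cInf_greatest) auto

text \<open>The infimum is attained, because a set of \<open>n + 1\<close> indices on which \<open>\<bar>x\<bar> > l\<close> has a least value
  of \<open>\<bar>x\<bar>\<close>, still above \<open>l\<close>.\<close>

lemma rearr_le_iff:
  assumes "bounded (range x)" "0 \<le> l"
  shows "rearr x n \<le> l \<longleftrightarrow> finite {k. l < \<bar>x k\<bar>} \<and> card {k. l < \<bar>x k\<bar>} \<le> n"
proof
  assume le: "rearr x n \<le> l"
  show "finite {k. l < \<bar>x k\<bar>} \<and> card {k. l < \<bar>x k\<bar>} \<le> n"
  proof (rule ccontr)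
    assume "\<not> ?thesis"
    then obtain F where F: "F \<subseteq> {k. l < \<bar>x k\<bar>}" "finite F" "card F = Suc n"
      by (metis Suc_leI infinite_arbitrarily_large not_le obtain_subset_with_card_n)
    define m where "m = Min ((\<lambda>k. \<bar>x k\<bar>) ` F)"
    have "F \<noteq> {}" using F by auto
    then have "l < m" using F unfolding m_def by (subst Min_gr_iff) auto
    have "m \<le> rearr x n"
      unfolding rearr_eq_Inf
    proof (rule cInf_greatest[OF rearr_levels_nonempty[OF assms(1)]])
      fix j assume j: "j \<in> {l. 0 \<le> l \<and> finite {k. l < \<bar>x k\<bar>} \<and> card {k. l < \<bar>x k\<bar>} \<le> n}"
      show "m \<le> j"
      proof (rule ccontr)
        assume "\<not> m \<le> j"
        have "F \<subseteq> {k. j < \<bar>x k\<bar>}"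
        proof
          fix k assume "k \<in> F"
          then have "m \<le> \<bar>x k\<bar>" unfolding m_def using F by simp
          then show "k \<in> {k. j < \<bar>x k\<bar>}" using \<open>\<not> m \<le> j\<close> by simp
        qed
        then have "card F \<le> n" using j card_mono by (metis (mono_tags, lifting) le_trans mem_Collect_eq)
        then show False using F by simp
      qed
    qed
    then show False using le \<open>l < m\<close> by simp
  qed
qed (use assms rearr_le in auto)

lemma rearr_antimono:
  assumes "bounded (range x)" "m \<le> n"
  shows "rearr x n \<le> rearr x m"
proof -
  have "finite {k. rearr x m < \<bar>x k\<bar>} \<and> card {k. rearr x m < \<bar>x k\<bar>} \<le> m"
    using rearr_le_iff[OF assms(1) rearr_nonneg[OF assms(1)], of m m] by simp
  then show ?thesis using assms rearr_nonneg by (intro rearr_le) auto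
qed

lemma rearr_mono:
  assumes "bounded (range y)" "\<And>k. \<bar>x k\<bar> \<le> \<bar>y k\<bar>"
  shows "rearr x n \<le> rearr y n"
proof -
  let ?A = "{k. rearr y n < \<bar>y k\<bar>}"
  have A: "finite ?A" "card ?A \<le> n"
    using rearr_le_iff[OF assms(1) rearr_nonneg[OF assms(1)], of n n] by auto
  have sub: "{k. rearr y n < \<bar>x k\<bar>} \<subseteq> ?A"
    using assms(2) by (auto intro: less_le_trans)
  show ?thesis
    using A finite_subset[OF sub] card_mono[OF _ sub] assms rearr_nonneg by (intro rearr_le) auto
qed

lemma rearr_le_self:
  assumes "decseq u" "\<And>k. 0 \<le> u k"
  shows "rearr u n \<le> u n"
proof -
  have sub: "{k. u n < \<bar>u k\<bar>} \<subseteq> {..<n}"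
  proof
    fix k assume "k \<in> {k. u n < \<bar>u k\<bar>}"
    then show "k \<in> {..<n}" using assms(2)[of k] decseqD[OF assms(1), of n k] by force
  qed
  show ?thesis
    using finite_subset[OF sub] card_mono[OF _ sub] assms by (intro rearr_le) auto
qed

lemma equimeasurable_rearr:
  assumes "bounded (range x)"
  shows "equimeasurable (rearr x) x"
  unfolding equimeasurable_def
proof (intro allI impI)
  fix l :: real assume l: "0 \<le> l"
  let ?A = "{k. l < \<bar>x k\<bar>}"
  have "{n. l < \<bar>rearr x n\<bar>} = {n. \<not> (finite ?A \<and> card ?A \<le> n)}"
    using rearr_le_iff[OF assms l] rearr_nonneg[OF assms] by (auto simp: not_le[symmetric])
  also have "\<dots> = (if finite ?A then {..<card ?A} else UNIV)"
    by auto
  finally show "distr_fun (rearr x) l = distr_fun x l"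
    by (auto simp: distr_fun_def emeasure_count_space)
qed

lemma equimeasurable_sym: "equimeasurable x y \<Longrightarrow> equimeasurable y x"
  by (simp add: equimeasurable_def)

lemma rearr_cong_equimeasurable: "equimeasurable x y \<Longrightarrow> rearr x = rearr y"
  unfolding rearr_def equimeasurable_def by (metis (no_types, lifting) Collect_cong ext)

lemma bounded_prod:
  fixes f g :: "nat \<Rightarrow> real"
  assumes "bounded (range f)" "bounded (range g)"
  shows "bounded (range (\<lambda>n. f n * g n))"
proof -
  obtain K L where K: "\<And>n. \<bar>f n\<bar> \<le> K" and L: "\<And>n. \<bar>g n\<bar> \<le> L"
    using assms by (auto simp: bounded_iff)
  have "\<bar>f n * g n\<bar> \<le> K * L" for n
    unfolding abs_mult using K[of n] L[of n] by (intro mult_mono) auto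
  then show ?thesis by (auto simp: bounded_iff)
qed

text \<open>A product exceeds a product of two levels only where one of the factors exceeds its level, so
  halving the index pays for multiplying rearrangements.\<close>

lemma rearr_mult_le:
  assumes f: "bounded (range f)" and g: "bounded (range g)"
  shows "rearr (\<lambda>k. f k * g k) m \<le> rearr f (m div 2) * rearr g (m div 2)"
proof -
  let ?n = "m div 2"
  let ?A = "{k. rearr f ?n < \<bar>f k\<bar>}" and ?B = "{k. rearr g ?n < \<bar>g k\<bar>}"
  let ?C = "{k. rearr f ?n * rearr g ?n < \<bar>f k * g k\<bar>}"
  have A: "finite ?A" "card ?A \<le> ?n"
    using rearr_le_iff[OF f rearr_nonneg[OF f], of ?n ?n] by auto
  have B: "finite ?B" "card ?B \<le> ?n"
    using rearr_le_iff[OF g rearr_nonneg[OF g], of ?n ?n] by auto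
  have sub: "?C \<subseteq> ?A \<union> ?B"
  proof
    fix k assume "k \<in> ?C"
    then have "\<not> (\<bar>f k\<bar> \<le> rearr f ?n \<and> \<bar>g k\<bar> \<le> rearr g ?n)"
      using mult_mono[of "\<bar>f k\<bar>" "rearr f ?n" "\<bar>g k\<bar>" "rearr g ?n"] rearr_nonneg[OF f]
      by (auto simp: abs_mult)
    then show "k \<in> ?A \<union> ?B" by auto
  qed
  have "card ?C \<le> card (?A \<union> ?B)" using A B sub by (intro card_mono) auto
  also have "\<dots> \<le> ?n + ?n" using card_Un_le[of ?A ?B] A B by linarith
  also have "\<dots> \<le> m" by simp
  finally show ?thesis
    using A B finite_subset[OF sub] rearr_nonneg[OF f] rearr_nonneg[OF g] by (intro rearr_le) auto
qed

text \<open>Among \<open>n + 1\<close> indices the smallest value of \<open>\<bar>a\<bar>\<close> is at most \<open>rearr a n\<close>; remove an index where it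
  occurs and repeat.\<close>

lemma sum_le_sum_rearr:
  assumes a: "bounded (range a)"
  shows "finite S \<Longrightarrow> card S = n \<Longrightarrow> (\<Sum>k\<in>S. \<bar>a k\<bar>) \<le> (\<Sum>k<n. rearr a k)"
proof (induction n arbitrary: S)
  case 0
  then show ?case by simp
next
  case (Suc n)
  then have "S \<noteq> {}" by auto
  then obtain j where j: "j \<in> S" "\<And>k. k \<in> S \<Longrightarrow> \<bar>a j\<bar> \<le> \<bar>a k\<bar>"
    using ex_is_arg_min_if_finite[OF \<open>finite S\<close>, of "\<lambda>k. \<bar>a k\<bar>"]
    by (auto simp: is_arg_min_linorder)
  have "\<bar>a j\<bar> \<le> rearr a n"
  proof (rule ccontr)
    assume "\<not> ?thesis"
    then have sub: "S \<subseteq> {k. rearr a n < \<bar>a k\<bar>}" using j by force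
    have "finite {k. rearr a n < \<bar>a k\<bar>} \<and> card {k. rearr a n < \<bar>a k\<bar>} \<le> n"
      using rearr_le_iff[OF a rearr_nonneg[OF a], of n n] by simp
    then show False using card_mono[OF _ sub] Suc.prems by simp
  qed
  moreover have "(\<Sum>k\<in>S - {j}. \<bar>a k\<bar>) \<le> (\<Sum>k<n. rearr a k)"
    using Suc j by (intro Suc.IH) auto
  ultimately show ?case
    using sum.remove[OF \<open>finite S\<close> j(1), of "\<lambda>k. \<bar>a k\<bar>"] by simp
qed

text \<open>Summation by parts: since the partial sums of \<open>v - u\<close> are nonnegative, lowering the weight from
  \<open>w n\<close> to \<open>w (Suc n)\<close> on all of them only loses.\<close>

lemma sum_mult_mono_of_partial_sums:
  fixes u v w :: "nat \<Rightarrow> real"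
  assumes le: "\<And>n. (\<Sum>k<n. u k) \<le> (\<Sum>k<n. v k)" and w: "decseq w" "\<And>n. 0 \<le> w n"
  shows "(\<Sum>k<n. u k * w k) \<le> (\<Sum>k<n. v k * w k)"
proof -
  define z where "z k = v k - u k" for k
  have z: "0 \<le> (\<Sum>k<n. z k)" for n using le[of n] by (simp add: z_def sum_subtractf)
  have "(\<Sum>k<n. z k) * w n \<le> (\<Sum>k<n. z k * w k)"
  proof (induction n)
    case (Suc n)
    have "(\<Sum>k<Suc n. z k) * w (Suc n) \<le> (\<Sum>k<Suc n. z k) * w n"
      using w z by (intro mult_left_mono) (auto simp: decseq_Suc_iff simp del: sum.lessThan_Suc)
    then show ?case using Suc by (simp add: algebra_simps)
  qed simp
  moreover have "0 \<le> (\<Sum>k<n. z k) * w n" using z w by simp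
  ultimately show ?thesis by (simp add: z_def sum_subtractf left_diff_distrib)
qed

section \<open>Transport along injections\<close>

definition spread :: "(nat \<Rightarrow> nat) \<Rightarrow> (nat \<Rightarrow> real) \<Rightarrow> nat \<Rightarrow> real" where
  "spread s x m = (if m \<in> range s then x (inv s m) else 0)"

lemma spread_apply [simp]: "inj s \<Longrightarrow> spread s x (s n) = x n"
  by (simp add: spread_def)

lemma equimeasurable_spread:
  assumes "inj s"
  shows "equimeasurable (spread s x) x"
  unfolding equimeasurable_def
proof (intro allI impI)
  fix l :: real assume l: "0 \<le> l"
  have "{m. l < \<bar>spread s x m\<bar>} = s ` {n. l < \<bar>x n\<bar>}"
    using l assms by (auto simp: spread_def inj_eq split: if_splits)
  then show "distr_fun (spread s x) l = distr_fun x l"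
    using card_image[OF inj_on_subset[OF assms subset_UNIV]]
      finite_image_iff[OF inj_on_subset[OF assms subset_UNIV]]
    by (simp add: distr_fun_def emeasure_count_space)
qed

lemma bounded_spread:
  assumes "bounded (range x)"
  shows "bounded (range (spread s x))"
proof -
  obtain K where "\<And>k. \<bar>x k\<bar> \<le> K" using assms by (auto simp: bounded_iff)
  then have "\<bar>spread s x m\<bar> \<le> max K 0" for m
    by (auto simp: spread_def le_max_iff_disj)
  then show ?thesis by (auto simp: bounded_iff)
qed

lemma abs_spread_le:
  assumes "inj s" "\<And>n. \<bar>x n\<bar> \<le> \<bar>y (s n)\<bar>"
  shows "\<bar>spread s x m\<bar> \<le> \<bar>y m\<bar>"
  using assms by (auto simp: spread_def)

lemma injective_choice:
  fixes A :: "nat \<Rightarrow> 'a set"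
  assumes "\<And>n. finite (A n) \<Longrightarrow> n < card (A n)"
  obtains s where "inj s" "\<And>n. s n \<in> A n"
proof -
  have "\<exists>s. \<forall>n. s n \<in> A n - s ` {..<n}"
  proof (rule dependent_wf_choice[where R = less_than and P = "\<lambda>f n r. r \<in> A n - f ` {..<n}"])
    fix n and f :: "nat \<Rightarrow> 'a"
    have "\<not> A n \<subseteq> f ` {..<n}"
    proof
      assume sub: "A n \<subseteq> f ` {..<n}"
      then have "card (A n) \<le> card (f ` {..<n})" by (intro card_mono) auto
      also have "\<dots> \<le> n" using card_image_le[of "{..<n}" f] by simp
      finally show False using assms[of n] sub by (simp add: finite_subset)
    qed
    then show "\<exists>r. r \<in> A n - f ` {..<n}" by blast
  qed (auto simp: image_iff)
  then obtain s where s: "\<And>n. s n \<in> A n - s ` {..<n}" by blast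
  have "inj s"
  proof (rule linorder_injI)
    fix i j :: nat assume "i < j"
    then show "s i \<noteq> s j" using s[of j] by (metis DiffD2 imageI lessThan_iff)
  qed
  with s show ?thesis by (intro that) auto
qed

text \<open>If \<open>\<bar>g\<bar>\<close> increases strictly to a limit, no entry reaches \<open>rearr g n\<close>, whence the factor \<open>1 / 2\<close>. More
  than \<open>n\<close> indices satisfy the inequality at stage \<open>n\<close>, so a greedy choice never runs out.\<close>

lemma rearr_nearly_attained:
  assumes g: "bounded (range g)"
  obtains s where "inj s" "\<And>n. rearr g n / 2 \<le> \<bar>g (s n)\<bar>"
proof (rule injective_choice[of "\<lambda>n. {k. rearr g n / 2 \<le> \<bar>g k\<bar>}"])
  fix n
  assume fin: "finite {k. rearr g n / 2 \<le> \<bar>g k\<bar>}"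
  show "n < card {k. rearr g n / 2 \<le> \<bar>g k\<bar>}"
  proof (cases "rearr g n = 0")
    case True
    then show ?thesis using fin by simp
  next
    case False
    then have "\<not> rearr g n \<le> rearr g n / 2" using rearr_nonneg[OF g, of n] by simp
    moreover have sub: "{k. rearr g n / 2 < \<bar>g k\<bar>} \<subseteq> {k. rearr g n / 2 \<le> \<bar>g k\<bar>}" by auto
    ultimately show ?thesis
      using rearr_le_iff[OF g, of "rearr g n / 2" n] rearr_nonneg[OF g, of n]
        finite_subset[OF sub fin] card_mono[OF fin sub] by auto
  qed
qed (use that in auto)

text \<open>An unbounded \<open>g\<close> is infinitely often as large as one likes, so some injection aligns those
  places with the entries of \<open>u\<close>.\<close>

lemma bounded_if_spread_products_bounded:
  fixes u g :: "nat \<Rightarrow> real"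
  assumes u: "\<And>n. 0 < u n" and "\<And>s. inj s \<Longrightarrow> bounded (range (\<lambda>n. spread s u n * g n))"
  shows "bounded (range g)"
proof (rule ccontr)
  assume unb: "\<not> bounded (range g)"
  have "infinite {k. real n / u n \<le> \<bar>g k\<bar>}" for n
  proof
    assume fin: "finite {k. real n / u n \<le> \<bar>g k\<bar>}"
    define K where "K = (\<Sum>k\<in>{k. real n / u n \<le> \<bar>g k\<bar>}. \<bar>g k\<bar>) + real n / u n"
    have "\<bar>g k\<bar> \<le> K" for k
    proof (cases "real n / u n \<le> \<bar>g k\<bar>")
      case True
      then have "\<bar>g k\<bar> \<le> (\<Sum>k\<in>{k. real n / u n \<le> \<bar>g k\<bar>}. \<bar>g k\<bar>)"
        using fin by (intro member_le_sum) auto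
      then show ?thesis using u[of n] by (simp add: K_def add_increasing2)
    next
      case False
      then show ?thesis by (simp add: K_def add_increasing sum_nonneg)
    qed
    then show False using unb by (auto simp: bounded_iff)
  qed
  then have "\<And>n. finite {k. real n / u n \<le> \<bar>g k\<bar>} \<Longrightarrow> n < card {k. real n / u n \<le> \<bar>g k\<bar>}"
    by blast
  from injective_choice[of "\<lambda>n. {k. real n / u n \<le> \<bar>g k\<bar>}", OF this]
  obtain s where s: "inj s" "\<And>n. real n / u n \<le> \<bar>g (s n)\<bar>" by (metis mem_Collect_eq)
  obtain K where K: "\<And>n. \<bar>spread s u n * g n\<bar> \<le> K"
    using assms(2)[OF s(1)] by (auto simp: bounded_iff)
  obtain n where n: "K < real n" using reals_Archimedean2 by blast
  have "real n \<le> u n * \<bar>g (s n)\<bar>" using s(2)[of n] u[of n] by (simp add: field_simps)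
  also have "\<dots> \<le> K" using K[of "s n"] s(1) u[of n] by (simp add: abs_mult)
  finally show False using n by simp
qed

section \<open>Concave functions and their dilation indices\<close>

text \<open>The sum is split at \<open>r n\<close>. Each of the at most \<open>n\<close> late terms is at most \<open>\<theta> n / (r n)\<close>; the early
  ones sum inductively to at most \<open>C \<theta> (r n) \<le> C q \<theta> n\<close>, and \<open>C = 1 / (r (1 - q))\<close> solves \<open>C q + 1 / r = C\<close>.\<close>

lemma sum_div_le_of_dilation_growth:
  fixes \<theta> :: "real \<Rightarrow> real"
  assumes pos: "\<And>t. 0 < t \<Longrightarrow> 0 < \<theta> t" and mono: "mono_on {0<..} \<theta>"
    and r: "0 < r" "r < 1" and q: "0 \<le> q" "q < 1"
    and growth: "\<And>t. 0 < t \<Longrightarrow> \<theta> (r * t) \<le> q * \<theta> t"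
    and n: "0 < n"
  shows "(\<Sum>k<n. \<theta> (real (Suc k)) / real (Suc k)) \<le> 1 / (r * (1 - q)) * \<theta> (real n)"
  using n
proof (induction n rule: less_induct)
  case (less n)
  define C where "C = 1 / (r * (1 - q))"
  have "0 < C" using r q by (simp add: C_def)
  have C: "C * q + 1 / r = C" using r q by (simp add: C_def field_simps)
  define m where "m = nat \<lfloor>r * real n\<rfloor>"
  have m: "real m \<le> r * real n" "r * real n < real m + 1"
    using r less.prems unfolding m_def by simp_all
  have "r * real n < real n" using r less.prems by simp
  then have "m < n" using m by linarith
  have early: "(\<Sum>k<m. \<theta> (real (Suc k)) / real (Suc k)) \<le> C * q * \<theta> (real n)"
  proof (cases "m = 0")
    case True
    then show ?thesis using \<open>0 < C\<close> q pos[of "real n"] less.prems by simp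
  next
    case False
    have "(\<Sum>k<m. \<theta> (real (Suc k)) / real (Suc k)) \<le> C * \<theta> (real m)"
      using less.IH[OF \<open>m < n\<close>] False unfolding C_def by simp
    also have "\<dots> \<le> C * \<theta> (r * real n)"
      using m False \<open>0 < C\<close> by (intro mult_left_mono mono_onD[OF mono]) auto
    also have "\<dots> \<le> C * (q * \<theta> (real n))"
      using growth[of "real n"] less.prems \<open>0 < C\<close> by (intro mult_left_mono) auto
    finally show ?thesis by simp
  qed
  have "(\<Sum>k=m..<n. \<theta> (real (Suc k)) / real (Suc k)) \<le> (\<Sum>k=m..<n. \<theta> (real n) / (r * real n))"
  proof (rule sum_mono)
    fix k assume k: "k \<in> {m..<n}"
    show "\<theta> (real (Suc k)) / real (Suc k) \<le> \<theta> (real n) / (r * real n)"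
    proof (rule frac_le)
      show "\<theta> (real (Suc k)) \<le> \<theta> (real n)" using k by (intro mono_onD[OF mono]) auto
      show "0 \<le> \<theta> (real n)" using pos[of "real n"] less.prems by simp
      show "0 < r * real n" using r less.prems by simp
      show "r * real n \<le> real (Suc k)" using m k by simp
    qed
  qed
  also have "\<dots> = (real n - real m) * (\<theta> (real n) / (r * real n))"
    using \<open>m < n\<close> by (simp add: of_nat_diff)
  also have "\<dots> \<le> real n * (\<theta> (real n) / (r * real n))"
    using pos[of "real n"] less.prems r by (intro mult_right_mono) auto
  also have "\<dots> = 1 / r * \<theta> (real n)" using less.prems by simp
  finally have late: "(\<Sum>k=m..<n. \<theta> (real (Suc k)) / real (Suc k)) \<le> 1 / r * \<theta> (real n)" .
  have "(\<Sum>k<n. \<theta> (real (Suc k)) / real (Suc k)) \<le> C * q * \<theta> (real n) + 1 / r * \<theta> (real n)"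
    using early late sum.atLeastLessThan_concat[of 0 m n "\<lambda>k. \<theta> (real (Suc k)) / real (Suc k)"] \<open>m < n\<close>
    by (simp add: lessThan_atLeast0)
  also have "\<dots> = C * \<theta> (real n)" using C by (metis distrib_right)
  finally show ?case by (simp add: C_def)
qed

locale pos_mono_concave =
  fixes \<phi> :: "real \<Rightarrow> real"
  assumes pos: "0 < t \<Longrightarrow> 0 < \<phi> t" and mono: "mono_on {0<..} \<phi>" and concave: "concave_on {0<..} \<phi>"
begin

lemma quotient_antimono:
  assumes "0 < s" "s \<le> t"
  shows "\<phi> t / t \<le> \<phi> s / s"
proof (cases "s = t")
  case False
  then have "s < t" using assms by simp
  have chord: "(s - e) / (t - e) * \<phi> t \<le> \<phi> s" if "0 < e" "e < s" for e
  proof -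
    define u where "u = (s - e) / (t - e)"
    have u: "0 \<le> u" "u \<le> 1" using that \<open>s < t\<close> by (auto simp: u_def)
    have "u * (t - e) = s - e" using that \<open>s < t\<close> by (simp add: u_def)
    then have s: "(1 - u) * e + u * t = s" by (simp add: algebra_simps)
    have "(1 - u) * \<phi> e + u * \<phi> t \<le> \<phi> ((1 - u) *\<^sub>R e + u *\<^sub>R t)"
      using u that \<open>s < t\<close> by (intro concave_onD[OF concave]) auto
    moreover have "0 \<le> (1 - u) * \<phi> e" using u pos[of e] that by simp
    ultimately show ?thesis using s by (simp add: u_def)
  qed
  have "((\<lambda>e. (s - e) / (t - e) * \<phi> t) \<longlongrightarrow> (s - 0) / (t - 0) * \<phi> t) (at_right 0)"
    using assms by (intro tendsto_intros) auto
  moreover have "\<forall>\<^sub>F e in at_right 0. (s - e) / (t - e) * \<phi> t \<le> \<phi> s"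
    using assms chord by (intro eventually_at_rightI[of 0 s]) auto
  ultimately have "s / t * \<phi> t \<le> \<phi> s" using tendsto_upperbound by fastforce
  then show ?thesis using assms by (simp add: field_simps)
qed simp

lemma dilation_le:
  assumes "0 < s" "0 < t"
  shows "\<phi> (s * t) / \<phi> t \<le> max 1 s"
proof (cases "s \<le> 1")
  case True
  then have "\<phi> (s * t) \<le> \<phi> t" using assms by (intro mono_onD[OF mono]) auto
  then show ?thesis using pos[of t] assms by (simp add: le_max_iff_disj)
next
  case False
  then have "\<phi> (s * t) / (s * t) \<le> \<phi> t / t" using assms by (intro quotient_antimono) auto
  then have "\<phi> (s * t) \<le> s * \<phi> t" using assms by (simp add: field_simps)
  then show ?thesis using pos[of t] assms by (simp add: le_max_iff_disj pos_divide_le_eq)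
qed

lemma dil_sup_le:
  assumes "0 < s"
  shows "dil_sup \<phi> s \<le> max 1 s"
  unfolding dil_sup_def using assms dilation_le by (intro cSUP_least) auto

lemma le_dil_sup:
  assumes "0 < s" "0 < t"
  shows "\<phi> (s * t) \<le> dil_sup \<phi> s * \<phi> t"
proof -
  have "\<phi> (s * t) / \<phi> t \<le> dil_sup \<phi> s"
    unfolding dil_sup_def using assms dilation_le
    by (intro cSUP_upper bdd_aboveI[of _ "max 1 s"]) auto
  then show ?thesis using pos[of t] assms by (simp add: pos_divide_le_eq)
qed

lemma dil_sup_pos:
  assumes "0 < s"
  shows "0 < dil_sup \<phi> s"
proof -
  have "0 < dil_sup \<phi> s * \<phi> 1" using le_dil_sup[of s 1] pos[of s] assms by simp
  then show ?thesis using pos[of 1] by (simp add: zero_less_mult_iff)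
qed

text \<open>If \<open>dil_sup \<phi> s = s\<close> for all \<open>s > 1\<close>, then the quotient of logarithms is constantly \<open>1\<close>.\<close>

lemma gamma_index_gt_1D:
  assumes "1 < gamma_index \<phi>"
  obtains s where "1 < s" "dil_sup \<phi> s < s"
proof (rule ccontr)
  assume "\<not> thesis"
  then have dil: "dil_sup \<phi> s = s" if "1 < s" for s
    using that dil_sup_le[of s] \<open>\<And>s. 1 < s \<Longrightarrow> dil_sup \<phi> s < s \<Longrightarrow> thesis\<close>
    by (force simp: max_def)
  have "\<forall>\<^sub>F s in at_top. ereal (ln s) / ereal (ln (dil_sup \<phi> s)) = 1"
    using eventually_gt_at_top[of 1] by eventually_elim (auto simp: dil one_ereal_def)
  then have "((\<lambda>s. ereal (ln s) / ereal (ln (dil_sup \<phi> s))) \<longlongrightarrow> 1) at_top"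
    by (rule tendsto_eventually)
  then have "gamma_index \<phi> = 1"
    unfolding gamma_index_def by (intro tendsto_Lim) auto
  then show False using assms by simp
qed

text \<open>If \<open>dil_sup \<phi> s = 1\<close> for all \<open>s < 1\<close>, then the quotient of logarithms is constantly \<open>\<infinity>\<close>.\<close>

lemma delta_index_finiteD:
  assumes "delta_index \<phi> < \<infinity>"
  obtains s where "0 < s" "s < 1" "dil_sup \<phi> s < 1"
proof (rule ccontr)
  assume "\<not> thesis"
  then have dil: "dil_sup \<phi> s = 1" if "0 < s" "s < 1" for s
    using that dil_sup_le[of s] \<open>\<And>s. 0 < s \<Longrightarrow> s < 1 \<Longrightarrow> dil_sup \<phi> s < 1 \<Longrightarrow> thesis\<close>
    by (force simp: max_def)
  have "\<forall>\<^sub>F s in at_right 0. ereal (- ln s) / ereal (- ln (dil_sup \<phi> s)) = \<infinity>"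
  proof (rule eventually_at_rightI[of 0 1])
    fix s :: real assume "s \<in> {0<..<1}"
    then show "ereal (- ln s) / ereal (- ln (dil_sup \<phi> s)) = \<infinity>"
      using dil[of s] by (simp add: divide_ereal_def zero_ereal_def[symmetric])
  qed simp
  then have "((\<lambda>s. ereal (- ln s) / ereal (- ln (dil_sup \<phi> s))) \<longlongrightarrow> \<infinity>) (at_right 0)"
    by (rule tendsto_eventually)
  then have "delta_index \<phi> = \<infinity>"
    unfolding delta_index_def by (intro tendsto_Lim) auto
  then show False using assms by simp
qed

end

section \<open>Rearrangement invariant spaces\<close>

definition unit_seq :: "nat \<Rightarrow> nat \<Rightarrow> real" where
  "unit_seq k n = of_bool (n = k)"

lemma equimeasurable_unit_seq: "equimeasurable (unit_seq j) (unit_seq k)"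
proof -
  have "{n. l < \<bar>unit_seq i n\<bar>} = (if l < 1 then {i} else {})" if "0 \<le> l" for l i
    using that by (auto simp: unit_seq_def)
  then show ?thesis by (simp add: equimeasurable_def distr_fun_def emeasure_count_space)
qed

locale ri_space =
  fixes X :: seq_space
  assumes ri: "rearrangement_invariant X"
begin

lemma banach: "banach_seq_space X"
  using ri unfolding rearrangement_invariant_def koethe_space_def by blast

lemma zero_mem: "(\<lambda>_. 0) \<in> elems X"
  and add_mem: "x \<in> elems X \<Longrightarrow> y \<in> elems X \<Longrightarrow> (\<lambda>n. x n + y n) \<in> elems X"
  and scale_mem: "x \<in> elems X \<Longrightarrow> (\<lambda>n. c * x n) \<in> elems X"
  and norm_nonneg: "x \<in> elems X \<Longrightarrow> 0 \<le> snorm X x"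
  and norm_eq_0_iff: "x \<in> elems X \<Longrightarrow> snorm X x = 0 \<longleftrightarrow> x = (\<lambda>_. 0)"
  and norm_scale: "x \<in> elems X \<Longrightarrow> snorm X (\<lambda>n. c * x n) = \<bar>c\<bar> * snorm X x"
  and norm_triangle: "x \<in> elems X \<Longrightarrow> y \<in> elems X \<Longrightarrow>
    snorm X (\<lambda>n. x n + y n) \<le> snorm X x + snorm X y"
  using banach unfolding banach_seq_space_def by blast+

lemma
  assumes "y \<in> elems X" "\<And>n. \<bar>x n\<bar> \<le> \<bar>y n\<bar>"
  shows solid_mem: "x \<in> elems X" and solid_norm: "snorm X x \<le> snorm X y"
  using assms ri unfolding rearrangement_invariant_def koethe_space_def by blast+

lemma
  assumes "y \<in> elems X" "equimeasurable x y"
  shows equimeasurable_mem: "x \<in> elems X" and equimeasurable_norm: "snorm X x = snorm X y"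
  using assms ri unfolding rearrangement_invariant_def by blast+

lemma norm_zero: "snorm X (\<lambda>_. 0) = 0"
  using norm_eq_0_iff[OF zero_mem] by simp

lemma unit_seq_mem: "unit_seq k \<in> elems X"
proof -
  have "{n. unit_seq k n \<noteq> 0} = {k}" by (auto simp: unit_seq_def)
  then have "finite {n. unit_seq k n \<noteq> 0}" by simp
  then show ?thesis using ri unfolding rearrangement_invariant_def koethe_space_def by blast
qed

lemma norm_unit_seq: "snorm X (unit_seq k) = snorm X (unit_seq 0)"
  by (intro equimeasurable_norm unit_seq_mem equimeasurable_unit_seq)

lemma norm_unit_seq_pos: "0 < snorm X (unit_seq 0)"
proof -
  have "unit_seq 0 \<noteq> (\<lambda>_. 0)" by (auto simp: unit_seq_def fun_eq_iff)
  then show ?thesis using norm_nonneg[OF unit_seq_mem] norm_eq_0_iff[OF unit_seq_mem] by (metis less_eq_real_def)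
qed

lemma abs_le_norm:
  assumes "x \<in> elems X"
  shows "\<bar>x n\<bar> \<le> snorm X x / snorm X (unit_seq 0)"
proof -
  have "\<bar>x n\<bar> * snorm X (unit_seq 0) = snorm X (\<lambda>k. x n * unit_seq n k)"
    by (simp add: norm_scale unit_seq_mem norm_unit_seq[of n])
  also have "\<dots> \<le> snorm X x" using assms by (intro solid_norm) (auto simp: unit_seq_def)
  finally show ?thesis using norm_unit_seq_pos by (simp add: pos_le_divide_eq)
qed

lemma bounded_range_elem: "x \<in> elems X \<Longrightarrow> bounded (range x)"
  using abs_le_norm[of x] by (auto simp: bounded_iff)

lemma
  assumes "bounded (range x)" "rearr x \<in> elems X"
  shows mem_of_rearr: "x \<in> elems X" and norm_eq_norm_rearr: "snorm X x = snorm X (rearr x)"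
  using assms equimeasurable_mem equimeasurable_norm equimeasurable_sym equimeasurable_rearr by blast+

lemma
  assumes "x \<in> elems X"
  shows rearr_mem: "rearr x \<in> elems X" and norm_rearr: "snorm X (rearr x) = snorm X x"
  using assms equimeasurable_mem equimeasurable_norm equimeasurable_rearr bounded_range_elem by blast+

lemma
  assumes "x \<in> elems X" "inj s"
  shows spread_mem: "spread s x \<in> elems X" and norm_spread: "snorm X (spread s x) = snorm X x"
  using assms equimeasurable_mem equimeasurable_norm equimeasurable_spread by blast+

lemma
  assumes "spread s x \<in> elems X" "inj s"
  shows mem_of_spread: "x \<in> elems X" and norm_eq_norm_spread: "snorm X x = snorm X (spread s x)"
  using assms equimeasurable_mem equimeasurable_norm equimeasurable_sym equimeasurable_spread by blast+

text \<open>Doubling every entry adds a copy of the sequence on the even indices to one on the odd indices.\<close>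

lemma
  assumes "h \<in> elems X"
  shows dilation_mem: "(\<lambda>n. h (n div 2)) \<in> elems X"
    and norm_dilation: "snorm X (\<lambda>n. h (n div 2)) \<le> 2 * snorm X h"
proof -
  have inj: "inj (\<lambda>n. 2 * n :: nat)" "inj (\<lambda>n. 2 * n + 1 :: nat)" by (auto simp: inj_def)
  have "(\<lambda>n. h (n div 2)) = (\<lambda>n. spread (\<lambda>n. 2 * n) h n + spread (\<lambda>n. 2 * n + 1) h n)"
  proof
    fix n
    show "h (n div 2) = spread (\<lambda>n. 2 * n) h n + spread (\<lambda>n. 2 * n + 1) h n"
    proof (cases "even n")
      case True
      then obtain k where k: "n = 2 * k" by blast
      have "n \<notin> range (\<lambda>n. 2 * n + 1 :: nat)" using True by auto
      then show ?thesis using spread_apply[OF inj(1), of h k] k by (simp add: spread_def)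
    next
      case False
      then obtain k where k: "n = 2 * k + 1" using oddE by blast
      have "n \<notin> range (\<lambda>n. 2 * n :: nat)" using False by auto
      then show ?thesis using spread_apply[OF inj(2), of h k] k by (simp add: spread_def)
    qed
  qed
  then show "(\<lambda>n. h (n div 2)) \<in> elems X" "snorm X (\<lambda>n. h (n div 2)) \<le> 2 * snorm X h"
    using add_mem[OF spread_mem[OF assms inj(1)] spread_mem[OF assms inj(2)]]
      norm_triangle[OF spread_mem[OF assms inj(1)] spread_mem[OF assms inj(2)]]
      norm_spread[OF assms inj(1)] norm_spread[OF assms inj(2)] by simp_all
qed

end

locale fatou_ri_space = ri_space +
  assumes fatou: "fatou_property X"
begin

text \<open>The witness is \<open>\<Sum>k. (1/2) ^ Suc k * \<bar>u k\<bar>\<close>, whose partial sums stay in the unit ball.\<close>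

lemma dyadic_majorant:
  assumes u: "\<And>k. u k \<in> elems X" "\<And>k. snorm X (u k) \<le> 1"
  obtains F where "F \<in> elems X" "\<And>k n. (1/2) ^ Suc k * \<bar>u k n\<bar> \<le> F n"
proof -
  define v where "v k n = (1/2) ^ Suc k * \<bar>u k n\<bar>" for k n
  have v: "v k \<in> elems X" "snorm X (v k) \<le> (1/2) ^ Suc k" for k
  proof -
    have *: "(\<lambda>n. (1/2) ^ Suc k * u k n) \<in> elems X" using u by (intro scale_mem)
    show "v k \<in> elems X" by (rule solid_mem[OF *]) (simp add: v_def abs_mult)
    have "snorm X (v k) \<le> snorm X (\<lambda>n. (1/2) ^ Suc k * u k n)"
      by (rule solid_norm[OF *]) (simp add: v_def abs_mult)
    also have "\<dots> = (1/2) ^ Suc k * snorm X (u k)"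
      using norm_scale[OF u(1)[of k], of "(1/2) ^ Suc k"] by (simp del: power_Suc)
    also have "\<dots> \<le> (1/2) ^ Suc k * 1" using u by (intro mult_left_mono) auto
    finally show "snorm X (v k) \<le> (1/2) ^ Suc k" by simp
  qed
  have partial: "(\<lambda>n. \<Sum>k<N. v k n) \<in> elems X \<and> snorm X (\<lambda>n. \<Sum>k<N. v k n) \<le> 1 - (1/2) ^ N" for N
  proof (induction N)
    case 0
    then show ?case using zero_mem norm_zero by simp
  next
    case (Suc N)
    have "(1 - (1/2) ^ N) + (1/2) ^ Suc N = 1 - (1/2 :: real) ^ Suc N" by simp
    then show ?case
      using Suc add_mem[of "\<lambda>n. \<Sum>k<N. v k n" "v N"] norm_triangle[of "\<lambda>n. \<Sum>k<N. v k n" "v N"] v[of N]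
      by simp
  qed
  have summable: "summable (\<lambda>k. v k n)" for n
  proof (rule summable_comparison_test')
    show "summable (\<lambda>k. (1 / snorm X (unit_seq 0)) * (1/2 :: real) ^ Suc k)"
      by (intro summable_mult) (simp add: summable_geometric)
    fix k
    have "\<bar>v k n\<bar> \<le> snorm X (v k) / snorm X (unit_seq 0)" using abs_le_norm v by blast
    also have "\<dots> \<le> (1/2) ^ Suc k / snorm X (unit_seq 0)"
      using v norm_unit_seq_pos by (intro divide_right_mono) auto
    finally show "norm (v k n) \<le> (1 / snorm X (unit_seq 0)) * (1/2) ^ Suc k" by simp
  qed
  define F where "F n = (\<Sum>k. v k n)" for n
  have "(\<lambda>N. \<Sum>k<N. v k n) \<longlonglongrightarrow> F n" for n
    using summable_LIMSEQ[OF summable] by (simp add: F_def)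
  moreover have "snorm X (\<lambda>n. \<Sum>k<N. v k n) \<le> 1" for N
    using conjunct2[OF partial[of N]] by (rule order_trans) simp
  ultimately have "F \<in> elems X"
    using partial fatou[unfolded fatou_property_def, rule_format, of "\<lambda>N n. \<Sum>k<N. v k n" F] by blast
  moreover have "v k n \<le> F n" for k n
    unfolding F_def using sum_le_suminf[OF summable, of "{k}"] by (simp add: v_def)
  ultimately show ?thesis by (intro that[of F]) (auto simp: v_def)
qed

lemma positive_elem:
  obtains F where "F \<in> elems X" "\<And>n. 0 < F n"
proof -
  define u where "u k n = 1 / snorm X (unit_seq 0) * unit_seq k n" for k n
  have "u k \<in> elems X" "snorm X (u k) \<le> 1" for k
    using scale_mem[OF unit_seq_mem, of "1 / snorm X (unit_seq 0)" k]
      norm_scale[OF unit_seq_mem, of "1 / snorm X (unit_seq 0)" k] norm_unit_seq_pos norm_unit_seq[of k]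
    by (simp_all add: u_def[abs_def])
  then obtain F where F: "F \<in> elems X" "\<And>k n. (1/2) ^ Suc k * \<bar>u k n\<bar> \<le> F n"
    using dyadic_majorant[of u] by blast
  have "0 < F n" for n
  proof -
    have "0 < (1/2) ^ Suc n * \<bar>u n n\<bar>" using norm_unit_seq_pos by (simp add: u_def unit_seq_def)
    then show ?thesis using F(2)[of n n] by linarith
  qed
  then show ?thesis using F that by blast
qed

text \<open>Otherwise some \<open>u k\<close> in the unit ball satisfy \<open>\<Sum>n. \<bar>u k n * h n\<bar> > 4 ^ k\<close>, and the dyadic
  majorant of the \<open>u k\<close> has no summable product with \<open>h\<close>.\<close>

lemma koethe_dual_bdd_above:
  assumes h: "h \<in> elems (koethe_dual X)"
  shows "bdd_above ((\<lambda>f. \<Sum>n. \<bar>f n * h n\<bar>) ` {f \<in> elems X. snorm X f \<le> 1})"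
proof (rule ccontr)
  assume "\<not> ?thesis"
  then have "\<exists>f. f \<in> elems X \<and> snorm X f \<le> 1 \<and> K < (\<Sum>n. \<bar>f n * h n\<bar>)" for K
    unfolding bdd_above_def by (auto simp: not_le)
  then have "\<exists>u. \<forall>k. u k \<in> elems X \<and> snorm X (u k) \<le> 1 \<and> 4 ^ k < (\<Sum>n. \<bar>u k n * h n\<bar>)"
    by (intro choice) blast
  then obtain u where u: "\<And>k. u k \<in> elems X" "\<And>k. snorm X (u k) \<le> 1"
    "\<And>k. 4 ^ k < (\<Sum>n. \<bar>u k n * h n\<bar>)"
    by blast
  obtain F where F: "F \<in> elems X" "\<And>k n. (1/2) ^ Suc k * \<bar>u k n\<bar> \<le> F n"
    using dyadic_majorant[of u] u by blast
  have summable: "summable (\<lambda>n. \<bar>f n * h n\<bar>)" if "f \<in> elems X" for f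
    using h that by (simp add: koethe_dual_def multipliers_def ell1_def)
  have large: "(2 ^ k :: real) / 2 < (\<Sum>n. \<bar>F n * h n\<bar>)" for k
  proof -
    have "(4 :: real) ^ k = 2 ^ k * 2 ^ k" by (simp flip: power_mult_distrib)
    then have "(2 ^ k :: real) / 2 = (1/2) ^ Suc k * 4 ^ k" by (simp add: power_divide)
    also have "\<dots> < (1/2) ^ Suc k * (\<Sum>n. \<bar>u k n * h n\<bar>)"
      using u(3)[of k] by (intro mult_strict_left_mono) auto
    also have "\<dots> = (\<Sum>n. (1/2) ^ Suc k * \<bar>u k n * h n\<bar>)"
      using summable[OF u(1)] by (intro suminf_mult[symmetric])
    also have "\<dots> \<le> (\<Sum>n. \<bar>F n * h n\<bar>)"
    proof (intro suminf_le summable_mult summable u F)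
      fix n
      have "(1/2) ^ Suc k * \<bar>u k n\<bar> * \<bar>h n\<bar> \<le> F n * \<bar>h n\<bar>" by (intro mult_right_mono F) auto
      also have "\<dots> \<le> \<bar>F n * h n\<bar>" unfolding abs_mult by (intro mult_right_mono) auto
      finally show "(1/2) ^ Suc k * \<bar>u k n * h n\<bar> \<le> \<bar>F n * h n\<bar>" by (simp add: abs_mult mult.assoc)
    qed
    finally show ?thesis .
  qed
  obtain k where "2 * (\<Sum>n. \<bar>F n * h n\<bar>) < 2 ^ k"
    using real_arch_pow[of 2] by auto
  then show False using large[of k] by simp
qed

end

section \<open>Multipliers from Marcinkiewicz spaces\<close>

context pos_mono_concave
begin

lemma rearr_le_marcinkiewicz_norm:
  assumes f: "f \<in> elems (marcinkiewicz \<phi>)"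
  shows "rearr f n \<le> snorm (marcinkiewicz \<phi>) f / \<phi> (real (Suc n))"
proof -
  let ?t = "real (Suc n)"
  have bdd: "bounded (range f)"
    "bdd_above (range (\<lambda>n. \<phi> (real (Suc n)) / real (Suc n) * (\<Sum>k\<le>n. rearr f k)))"
    using f by (auto simp: marcinkiewicz_def)
  have "?t * rearr f n \<le> (\<Sum>k\<le>n. rearr f k)"
    using sum_bounded_below[of "{..n}" "rearr f n" "rearr f"] rearr_antimono[OF bdd(1)] by simp
  then have "\<phi> ?t / ?t * (?t * rearr f n) \<le> \<phi> ?t / ?t * (\<Sum>k\<le>n. rearr f k)"
    using pos[of ?t] by (intro mult_left_mono) auto
  also have "\<dots> \<le> snorm (marcinkiewicz \<phi>) f"
    using cSUP_upper[OF _ bdd(2), of n] by (simp add: marcinkiewicz_def)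
  finally show ?thesis using pos[of ?t] by (simp add: pos_le_divide_eq mult.commute)
qed

lemma marcinkiewicz_norm_nonneg:
  assumes f: "f \<in> elems (marcinkiewicz \<phi>)"
  shows "0 \<le> snorm (marcinkiewicz \<phi>) f"
proof -
  have "0 \<le> rearr f 0" using f by (intro rearr_nonneg) (simp add: marcinkiewicz_def)
  also have "\<dots> \<le> snorm (marcinkiewicz \<phi>) f / \<phi> (real (Suc 0))"
    using f by (rule rearr_le_marcinkiewicz_norm)
  finally show ?thesis using pos[of 1] by (simp add: zero_le_divide_iff)
qed

text \<open>The hypothesis on \<open>gamma_index\<close> says that \<open>t / \<phi> t\<close> grows under some dilation, which makes the
  averages of \<open>1 / \<phi>\<close> comparable to \<open>1 / \<phi>\<close>: this is membership of \<open>1 / \<phi>\<close> in the Marcinkiewicz space.\<close>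

lemma marcinkiewicz_contains_inverse:
  assumes "1 < gamma_index \<phi>"
  obtains C where "0 < C"
    "\<And>s. inj s \<Longrightarrow> spread s (\<lambda>n. 1 / (C * \<phi> (real (Suc n)))) \<in> elems (marcinkiewicz \<phi>)"
    "\<And>s. inj s \<Longrightarrow> snorm (marcinkiewicz \<phi>) (spread s (\<lambda>n. 1 / (C * \<phi> (real (Suc n))))) \<le> 1"
proof -
  obtain s where s: "1 < s" "dil_sup \<phi> s < s"
    using gamma_index_gt_1D assms by blast
  define q where "q = dil_sup \<phi> s / s"
  define C where "C = 1 / (1 / s * (1 - q))"
  have q: "0 < q" "q < 1" using s dil_sup_pos[of s] by (simp_all add: q_def)
  have "0 < C" using s q by (simp add: C_def)
  have sum_le: "(\<Sum>k<n. 1 / \<phi> (real (Suc k))) \<le> C * (real n / \<phi> (real n))" if "0 < n" for n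
  proof -
    have "(\<Sum>k<n. (\<lambda>t. t / \<phi> t) (real (Suc k)) / real (Suc k)) \<le> C * (\<lambda>t. t / \<phi> t) (real n)"
      unfolding C_def
    proof (rule sum_div_le_of_dilation_growth)
      show "mono_on {0<..} (\<lambda>t. t / \<phi> t)"
      proof (rule mono_onI)
        fix x y :: real assume xy: "x \<in> {0<..}" "x \<le> y"
        then have "\<phi> y / y \<le> \<phi> x / x" by (intro quotient_antimono) auto
        then show "x / \<phi> x \<le> y / \<phi> y" using pos[of x] pos[of y] xy by (simp add: field_simps)
      qed
      show "1 / s * t / \<phi> (1 / s * t) \<le> q * (t / \<phi> t)" if "0 < t" for t
      proof -
        have "\<phi> (s * (t / s)) \<le> dil_sup \<phi> s * \<phi> (t / s)"
          using s that by (intro le_dil_sup) auto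
        then show ?thesis using pos[of t] pos[of "t / s"] s that by (simp add: q_def field_simps)
      qed
    qed (use s q pos that in auto)
    then show ?thesis by simp
  qed
  define u where "u n = 1 / (C * \<phi> (real (Suc n)))" for n
  have dec: "decseq u"
    unfolding u_def using \<open>0 < C\<close> pos
    by (intro decseq_SucI divide_left_mono mult_left_mono mono_onD[OF mono] mult_pos_pos) auto
  have upos: "0 < u n" for n using \<open>0 < C\<close> pos by (simp add: u_def)
  have bdd: "bounded (range u)"
    using decseqD[OF dec, of 0] upos by (auto simp: bounded_iff abs_of_pos intro!: exI[of _ "u 0"])
  have mean: "\<phi> (real (Suc n)) / real (Suc n) * (\<Sum>k\<le>n. rearr (spread s u) k) \<le> 1" if "inj s" for s n
  proof -
    have "(\<Sum>k\<le>n. rearr (spread s u) k) = (\<Sum>k\<le>n. rearr u k)"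
      using rearr_cong_equimeasurable[OF equimeasurable_spread[OF that]] by simp
    also have "\<dots> \<le> (\<Sum>k\<le>n. u k)"
      using rearr_le_self[OF dec] upos by (intro sum_mono) (simp add: less_imp_le)
    also have "\<dots> = 1 / C * (\<Sum>k<Suc n. 1 / \<phi> (real (Suc k)))"
      unfolding u_def lessThan_Suc_atMost sum_distrib_left by simp
    also have "\<dots> \<le> 1 / C * (C * (real (Suc n) / \<phi> (real (Suc n))))"
      using sum_le[of "Suc n"] \<open>0 < C\<close> by (intro mult_left_mono) auto
    finally have "(\<Sum>k\<le>n. rearr (spread s u) k) \<le> real (Suc n) / \<phi> (real (Suc n))"
      using \<open>0 < C\<close> by simp
    then have "\<phi> (real (Suc n)) / real (Suc n) * (\<Sum>k\<le>n. rearr (spread s u) k)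
        \<le> \<phi> (real (Suc n)) / real (Suc n) * (real (Suc n) / \<phi> (real (Suc n)))"
      using pos[of "real (Suc n)"] by (intro mult_left_mono) auto
    also have "\<dots> = 1" using pos[of "real (Suc n)"] by simp
    finally show ?thesis .
  qed
  have "spread s u \<in> elems (marcinkiewicz \<phi>)" if "inj s" for s
    using bounded_spread[OF bdd] mean[OF that] by (auto simp: marcinkiewicz_def intro!: bdd_aboveI[of _ 1])
  moreover have "snorm (marcinkiewicz \<phi>) (spread s u) \<le> 1" if "inj s" for s
    using mean[OF that] by (simp add: marcinkiewicz_def cSUP_least)
  ultimately show ?thesis using \<open>0 < C\<close> that[of C] unfolding u_def[abs_def] by blast
qed

text \<open>The map \<open>h\<close> sends \<open>g\<close> to the sequence whose norm in \<open>Y\<close> is the right-hand norm of \<open>g\<close>. The bound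
  from below comes from the single test sequence \<open>1 / (C \<phi>)\<close>, moved to where \<open>g\<close> is large.\<close>

theorem multipliers_marcinkiewicz:
  assumes Y: "rearrangement_invariant Y" and gamma: "1 < gamma_index \<phi>"
  shows "same_space (multipliers (marcinkiewicz \<phi>) Y) (symmetrization (weighted Y (\<lambda>t. 1 / \<phi> t)))"
proof -
  interpret Y: ri_space Y by unfold_locales (fact Y)
  let ?M = "marcinkiewicz \<phi>"
  define h where "h g n = rearr g n * (1 / \<phi> (real (Suc n)))" for g n
  obtain C where C: "0 < C"
    "\<And>s. inj s \<Longrightarrow> spread s (\<lambda>n. 1 / (C * \<phi> (real (Suc n)))) \<in> elems ?M"
    "\<And>s. inj s \<Longrightarrow> snorm ?M (spread s (\<lambda>n. 1 / (C * \<phi> (real (Suc n))))) \<le> 1"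
    using marcinkiewicz_contains_inverse[OF gamma] by blast
  define u where "u n = 1 / (C * \<phi> (real (Suc n)))" for n
  have upos: "0 < u n" for n using C(1) pos by (simp add: u_def)
  have u: "spread s u \<in> elems ?M" "snorm ?M (spread s u) \<le> 1" if "inj s" for s
    using C(2,3)[OF that] unfolding u_def[abs_def] by auto
  have upper: "(\<lambda>n. f n * g n) \<in> elems Y \<and>
      snorm Y (\<lambda>n. f n * g n) \<le> 2 * snorm ?M f * snorm Y (h g)"
    if g: "bounded (range g)" and hg: "h g \<in> elems Y" and f: "f \<in> elems ?M" for f g
  proof -
    let ?y = "\<lambda>n. snorm ?M f * h g (n div 2)" and ?fg = "\<lambda>n. f n * g n"
    have fb: "bounded (range f)" using f by (simp add: marcinkiewicz_def)
    have y: "?y \<in> elems Y" by (intro Y.scale_mem Y.dilation_mem hg)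
    have "rearr ?fg n \<le> ?y n" for n
    proof -
      have "rearr ?fg n \<le> rearr f (n div 2) * rearr g (n div 2)" using rearr_mult_le[OF fb g] .
      also have "\<dots> \<le> snorm ?M f / \<phi> (real (Suc (n div 2))) * rearr g (n div 2)"
        using rearr_le_marcinkiewicz_norm[OF f] rearr_nonneg[OF g] by (intro mult_right_mono) auto
      finally show ?thesis by (simp add: h_def)
    qed
    then have le: "\<bar>rearr ?fg n\<bar> \<le> \<bar>?y n\<bar>" for n
      using rearr_nonneg[OF bounded_prod[OF fb g], of n] by (smt (verit))
    have mem: "rearr ?fg \<in> elems Y" by (rule Y.solid_mem[OF y le])
    have "snorm Y (rearr ?fg) \<le> snorm Y ?y" by (rule Y.solid_norm[OF y le])
    also have "\<dots> = snorm ?M f * snorm Y (\<lambda>n. h g (n div 2))"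
      using Y.norm_scale[OF Y.dilation_mem[OF hg]] marcinkiewicz_norm_nonneg[OF f] by simp
    also have "\<dots> \<le> snorm ?M f * (2 * snorm Y (h g))"
      by (intro mult_left_mono Y.norm_dilation hg marcinkiewicz_norm_nonneg f)
    finally show ?thesis
      using Y.mem_of_rearr[OF bounded_prod[OF fb g] mem] Y.norm_eq_norm_rearr[OF bounded_prod[OF fb g] mem]
      by simp
  qed
  have lower: "bounded (range g) \<and> h g \<in> elems Y \<and>
      (\<exists>f\<in>elems ?M. snorm ?M f \<le> 1 \<and> snorm Y (h g) \<le> 2 * C * snorm Y (\<lambda>n. f n * g n))"
    if g: "g \<in> elems (multipliers ?M Y)" for g
  proof -
    have fg: "(\<lambda>n. f n * g n) \<in> elems Y" if "f \<in> elems ?M" for f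
      using g that by (simp add: multipliers_def)
    have "bounded (range (\<lambda>n. spread s u n * g n))" if "inj s" for s
      using Y.bounded_range_elem[OF fg[OF u(1)[OF that]]] .
    then have gb: "bounded (range g)" by (rule bounded_if_spread_products_bounded[OF upos])
    obtain s where s: "inj s" "\<And>n. rearr g n / 2 \<le> \<bar>g (s n)\<bar>"
      using rearr_nearly_attained[OF gb] by blast
    let ?f = "spread s u"
    define k where "k n = 1 / (2 * C) * h g n" for n
    have le: "\<bar>k n\<bar> \<le> \<bar>?f (s n) * g (s n)\<bar>" for n
    proof -
      have "\<bar>k n\<bar> = u n * (rearr g n / 2)"
        using C(1) pos[of "real (Suc n)"] rearr_nonneg[OF gb, of n] by (simp add: k_def h_def u_def abs_mult)
      also have "\<dots> \<le> u n * \<bar>g (s n)\<bar>" using s(2) upos[of n] by (intro mult_left_mono) auto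
      also have "\<dots> = \<bar>?f (s n) * g (s n)\<bar>" using s(1) upos[of n] by (simp add: abs_mult)
      finally show ?thesis .
    qed
    have sol: "\<bar>spread s k m\<bar> \<le> \<bar>?f m * g m\<bar>" for m
      using abs_spread_le[OF s(1), of k "\<lambda>m. ?f m * g m"] le by blast
    have fgY: "(\<lambda>n. ?f n * g n) \<in> elems Y" using fg[OF u(1)[OF s(1)]] .
    have sk: "spread s k \<in> elems Y" by (rule Y.solid_mem[OF fgY sol])
    have "snorm Y (spread s k) \<le> snorm Y (\<lambda>n. ?f n * g n)" by (rule Y.solid_norm[OF fgY sol])
    then have kY: "k \<in> elems Y" "snorm Y k \<le> snorm Y (\<lambda>n. ?f n * g n)"
      using Y.mem_of_spread[OF sk s(1)] Y.norm_eq_norm_spread[OF sk s(1)] by auto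
    have "h g = (\<lambda>n. 2 * C * k n)" using C(1) by (auto simp: k_def)
    then have "h g \<in> elems Y" "snorm Y (h g) \<le> 2 * C * snorm Y (\<lambda>n. ?f n * g n)"
      using Y.scale_mem[OF kY(1), of "2 * C"] Y.norm_scale[OF kY(1), of "2 * C"] kY(2) C(1) by auto
    then show ?thesis using gb u[OF s(1)] by blast
  qed
  let ?A = "multipliers ?M Y" and ?B = "symmetrization (weighted Y (\<lambda>t. 1 / \<phi> t))"
  have B: "g \<in> elems ?B \<longleftrightarrow> bounded (range g) \<and> h g \<in> elems Y" "snorm ?B g = snorm Y (h g)" for g
    by (simp_all add: symmetrization_def weighted_def h_def[abs_def])
  have "elems ?A = elems ?B"
    using lower upper B(1) by (auto simp: multipliers_def)
  moreover have "1 / (2 * C) * snorm ?B g \<le> snorm ?A g \<and> snorm ?A g \<le> 2 * snorm ?B g"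
    if g: "g \<in> elems ?A" for g
  proof -
    let ?ball = "{f \<in> elems ?M. snorm ?M f \<le> 1}"
    have A: "snorm ?A g = (SUP f\<in>?ball. snorm Y (\<lambda>n. f n * g n))" by (simp add: multipliers_def)
    have gb: "bounded (range g)" "h g \<in> elems Y" using lower[OF g] by auto
    obtain f where f: "f \<in> ?ball" "snorm Y (h g) \<le> 2 * C * snorm Y (\<lambda>n. f n * g n)"
      using lower[OF g] by blast
    have ball: "snorm Y (\<lambda>n. f n * g n) \<le> 2 * snorm Y (h g)" if "f \<in> ?ball" for f
    proof -
      have "snorm Y (\<lambda>n. f n * g n) \<le> 2 * snorm ?M f * snorm Y (h g)" using upper gb that by blast
      also have "\<dots> \<le> 2 * 1 * snorm Y (h g)"
        using that Y.norm_nonneg[OF gb(2)] by (intro mult_right_mono mult_left_mono) auto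
      finally show ?thesis by simp
    qed
    have "snorm Y (\<lambda>n. f n * g n) \<le> snorm ?A g"
      unfolding A using ball f by (intro cSUP_upper bdd_aboveI[of _ "2 * snorm Y (h g)"]) auto
    then have "2 * C * snorm Y (\<lambda>n. f n * g n) \<le> 2 * C * snorm ?A g" using C(1) by simp
    then have "snorm Y (h g) \<le> 2 * C * snorm ?A g" using f(2) by linarith
    moreover have "snorm ?A g \<le> 2 * snorm Y (h g)"
      unfolding A using ball f by (intro cSUP_least) auto
    ultimately show ?thesis using C(1) unfolding B by (simp add: field_simps)
  qed
  ultimately show ?thesis
    unfolding same_space_def using C(1)
    by (intro conjI exI[of _ "1 / (2 * C)"] exI[of _ 2]) auto
qed

end

section \<open>Multipliers into Lorentz spaces\<close>

context pos_mono_concave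
begin

text \<open>The weight of the Lorentz norm, and the weight that appears on the dual side.\<close>

abbreviation weight_incr :: "nat \<Rightarrow> real" where
  "weight_incr n \<equiv> \<phi> (real (Suc n) + 1) - \<phi> (real (Suc n))"

abbreviation weight_mean :: "nat \<Rightarrow> real" where
  "weight_mean n \<equiv> \<phi> (real (Suc n)) / real (Suc n)"

lemma weight_incr_nonneg: "0 \<le> weight_incr n"
  using mono_onD[OF mono, of "real (Suc n)" "real (Suc n) + 1"] by simp

lemma weight_incr_le_mean: "weight_incr n \<le> weight_mean n"
proof -
  let ?t = "real (Suc n)"
  have "\<phi> (?t + 1) / (?t + 1) \<le> \<phi> ?t / ?t" by (intro quotient_antimono) auto
  then have "\<phi> (?t + 1) \<le> \<phi> ?t / ?t * (?t + 1)" by (simp add: pos_divide_le_eq)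
  also have "\<dots> = \<phi> ?t + \<phi> ?t / ?t" by (simp add: field_simps)
  finally show ?thesis by simp
qed

lemma weight_mean_pos: "0 < weight_mean n"
  using pos[of "real (Suc n)"] by simp

lemma weight_mean_decseq: "decseq weight_mean"
  by (intro decseq_SucI quotient_antimono) auto

text \<open>The hypothesis on \<open>delta_index\<close> says that \<open>\<phi>\<close> grows under some dilation. This bounds the sums of
  the means by multiples of \<open>\<phi> n\<close>, and it excludes \<open>\<phi> 1 = \<phi> 2\<close> (a concave \<open>\<phi>\<close> would then be constant from
  \<open>1\<close> on), so that \<open>\<phi> n\<close> is in turn at most a multiple of the telescoping sum \<open>\<phi> (n + 1) - \<phi> 1\<close>.\<close>

lemma sum_weight_mean_le:
  assumes "delta_index \<phi> < \<infinity>"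
  obtains C where "0 < C" "\<And>n. (\<Sum>k<n. weight_mean k) \<le> (\<Sum>k<n. C * weight_incr k)"
proof -
  obtain r where r: "0 < r" "r < 1" "dil_sup \<phi> r < 1"
    using delta_index_finiteD assms by blast
  define q where "q = dil_sup \<phi> r"
  have q: "0 \<le> q" "q < 1" using r dil_sup_pos[of r] by (simp_all add: q_def)
  define D where "D = 1 / (r * (1 - q))"
  have "0 < D" using r q by (simp add: D_def)
  have growth: "\<phi> (r * t) \<le> q * \<phi> t" if "0 < t" for t
    using le_dil_sup r that by (simp add: q_def)
  have "\<phi> 1 < \<phi> 2"
  proof -
    define t where "t = 2 / r"
    define v where "v = 1 / (t - 1)"
    have "2 < t" using r by (simp add: t_def field_simps)
    then have v: "0 < v" "v \<le> 1" by (auto simp: v_def)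
    have "v * (t - 1) = 1" using \<open>2 < t\<close> by (simp add: v_def)
    then have conv: "(1 - v) * 1 + v * t = 2" by (simp add: algebra_simps)
    have "\<phi> 1 \<le> \<phi> (r * t)" using r by (intro mono_onD[OF mono]) (auto simp: t_def)
    also have "\<dots> \<le> q * \<phi> t" using growth \<open>2 < t\<close> by simp
    also have "\<dots> < 1 * \<phi> t" using q pos[of t] \<open>2 < t\<close> by (intro mult_strict_right_mono) auto
    finally have "v * \<phi> 1 < v * \<phi> t" using v by simp
    moreover have "(1 - v) * \<phi> 1 + v * \<phi> t \<le> \<phi> ((1 - v) *\<^sub>R 1 + v *\<^sub>R t)"
      using v \<open>2 < t\<close> by (intro concave_onD[OF concave]) auto
    ultimately show ?thesis using conv by (simp add: algebra_simps)
  qed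
  define c where "c = 1 - \<phi> 1 / \<phi> 2"
  have "0 < c" using \<open>\<phi> 1 < \<phi> 2\<close> pos[of 2] by (simp add: c_def)
  have "(\<Sum>k<n. weight_mean k) \<le> (\<Sum>k<n. D / c * weight_incr k)" for n
  proof (cases "n = 0")
    case False
    have "(\<Sum>k<n. weight_incr k) = (\<Sum>k<n. \<phi> (real (Suc (Suc k))) - \<phi> (real (Suc k)))"
      by (simp add: add.commute)
    also have "\<dots> = \<phi> (real (Suc n)) - \<phi> 1"
      using sum_lessThan_telescope[of "\<lambda>k. \<phi> (real (Suc k))" n] by simp
    finally have telescope: "(\<Sum>k<n. weight_incr k) = \<phi> (real (Suc n)) - \<phi> 1" .
    have "\<phi> 2 \<le> \<phi> (real (Suc n))" using False by (intro mono_onD[OF mono]) auto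
    then have "\<phi> 1 \<le> \<phi> 1 / \<phi> 2 * \<phi> (real (Suc n))"
      using pos[of 1] pos[of 2] by (simp add: field_simps)
    then have incr: "c * \<phi> (real (Suc n)) \<le> (\<Sum>k<n. weight_incr k)"
      unfolding telescope by (simp add: c_def algebra_simps)
    have "(\<Sum>k<n. weight_mean k) \<le> D * \<phi> (real n)"
      unfolding D_def using sum_div_le_of_dilation_growth[OF pos mono r(1,2) q growth] False by simp
    also have "\<dots> \<le> D * \<phi> (real (Suc n))"
      using \<open>0 < D\<close> False by (intro mult_left_mono mono_onD[OF mono]) auto
    also have "\<dots> = D / c * (c * \<phi> (real (Suc n)))" using \<open>0 < c\<close> by simp
    also have "\<dots> \<le> D / c * (\<Sum>k<n. weight_incr k)"
      using \<open>0 < c\<close> \<open>0 < D\<close> incr by (intro mult_left_mono) auto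
    finally show ?thesis by (simp add: sum_distrib_left)
  qed simp
  then show ?thesis using that[of "D / c"] \<open>0 < c\<close> \<open>0 < D\<close> by simp
qed

lemma
  assumes "bounded (range x)" "summable (\<lambda>n. rearr x n * weight_mean n)"
  shows lorentz_mem_of_summable_means: "x \<in> elems (lorentz \<phi>)"
    and lorentz_norm_le_sum_means: "snorm (lorentz \<phi>) x \<le> (\<Sum>n. rearr x n * weight_mean n)"
proof -
  have le: "rearr x n * weight_incr n \<le> rearr x n * weight_mean n" for n
    using rearr_nonneg[OF assms(1)] weight_incr_le_mean by (intro mult_left_mono)
  have sum: "summable (\<lambda>n. rearr x n * weight_incr n)"
    using le rearr_nonneg[OF assms(1)] weight_incr_nonneg
    by (intro summable_comparison_test'[OF assms(2)]) (auto simp: abs_mult)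
  then show "x \<in> elems (lorentz \<phi>)" using assms by (simp add: lorentz_def)
  show "snorm (lorentz \<phi>) x \<le> (\<Sum>n. rearr x n * weight_mean n)"
    using suminf_le[OF le sum assms(2)] by (simp add: lorentz_def)
qed

lemma sum_rearr_means_le_lorentz_norm:
  assumes "0 < C" "\<And>n. (\<Sum>k<n. weight_mean k) \<le> (\<Sum>k<n. C * weight_incr k)"
    and x: "x \<in> elems (lorentz \<phi>)"
  shows "(\<Sum>k<n. rearr x k * weight_mean k) \<le> C * snorm (lorentz \<phi>) x"
proof -
  have b: "bounded (range x)" and s: "summable (\<lambda>n. rearr x n * weight_incr n)"
    using x by (auto simp: lorentz_def)
  have "(\<Sum>k<n. weight_mean k * rearr x k) \<le> (\<Sum>k<n. C * weight_incr k * rearr x k)"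
    using rearr_nonneg[OF b] rearr_antimono[OF b] assms(2)
    by (intro sum_mult_mono_of_partial_sums) (auto simp: decseq_def)
  also have "\<dots> = C * (\<Sum>k<n. rearr x k * weight_incr k)"
    by (simp add: sum_distrib_left mult_ac)
  also have "\<dots> \<le> C * (\<Sum>k. rearr x k * weight_incr k)"
    using assms(1) rearr_nonneg[OF b] weight_incr_nonneg
    by (intro mult_left_mono sum_le_suminf s) auto
  finally show ?thesis by (simp add: lorentz_def mult.commute)
qed

text \<open>The Hardy--Littlewood inequality for the decreasing weight \<open>weight_mean\<close>.\<close>

lemma sum_means_le_sum_rearr_means:
  assumes "bounded (range a)"
  shows "(\<Sum>k<n. \<bar>a k\<bar> * weight_mean k) \<le> (\<Sum>k<n. rearr a k * weight_mean k)"
  using sum_le_sum_rearr[OF assms] weight_mean_decseq weight_mean_pos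
  by (intro sum_mult_mono_of_partial_sums) (auto simp: less_imp_le)

text \<open>A general \<open>X\<close> has no largest sequence up to rearrangement to test on, so every \<open>f\<close> in \<open>X\<close> is moved to
  where \<open>g\<close> is large, and the rearrangement of the resulting product dominates that of \<open>\<bar>f\<bar> * rearr g / 2\<close>.\<close>

theorem multipliers_lorentz:
  assumes X: "rearrangement_invariant X" "fatou_property X" and delta: "delta_index \<phi> < \<infinity>"
  shows "same_space (multipliers X (lorentz \<phi>)) (symmetrization (weighted (koethe_dual X) (\<lambda>t. \<phi> t / t)))"
proof -
  interpret X: fatou_ri_space X by unfold_locales (fact X)+
  let ?L = "lorentz \<phi>" and ?D = "koethe_dual X"
  let ?ball = "{f \<in> elems X. snorm X f \<le> 1}"
  define h where "h g n = rearr g n * (\<phi> (real (Suc n)) / real (Suc n))" for g n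
  have D: "k \<in> elems ?D \<longleftrightarrow> (\<forall>f\<in>elems X. summable (\<lambda>n. \<bar>f n * k n\<bar>))"
    "snorm ?D k = (SUP f\<in>?ball. \<Sum>n. \<bar>f n * k n\<bar>)" for k
    by (simp_all add: koethe_dual_def multipliers_def ell1_def)
  obtain C where C: "0 < C" "\<And>n. (\<Sum>k<n. weight_mean k) \<le> (\<Sum>k<n. C * weight_incr k)"
    using sum_weight_mean_le[OF delta] by blast
  have zero_ball: "(\<lambda>_. 0) \<in> ?ball" using X.zero_mem X.norm_zero by simp
  have upper: "(\<lambda>n. f n * g n) \<in> elems ?L \<and>
      snorm ?L (\<lambda>n. f n * g n) \<le> 2 * (\<Sum>n. \<bar>rearr f n * h g n\<bar>)"
    if g: "bounded (range g)" and hg: "h g \<in> elems ?D" and f: "f \<in> elems X" for f g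
  proof -
    let ?fg = "\<lambda>n. f n * g n"
    have fb: "bounded (range f)" using X.bounded_range_elem[OF f] .
    have fgb: "bounded (range ?fg)" using bounded_prod[OF fb g] .
    define p where "p n = \<bar>rearr f n * h g n\<bar>" for n
    have p: "summable p" using hg X.rearr_mem[OF f] unfolding D p_def by blast
    have term_le: "rearr ?fg m * weight_mean m \<le> p (m div 2)" for m
    proof -
      have "rearr ?fg m * weight_mean m \<le> rearr f (m div 2) * rearr g (m div 2) * weight_mean (m div 2)"
        using rearr_mult_le[OF fb g] decseqD[OF weight_mean_decseq, of "m div 2" m] weight_mean_pos[of m]
          rearr_nonneg[OF fb] rearr_nonneg[OF g]
        by (intro mult_mono) auto
      also have "\<dots> = rearr f (m div 2) * h g (m div 2)" unfolding h_def by (simp only: mult.assoc)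
      also have "\<dots> \<le> p (m div 2)" unfolding p_def by (rule abs_ge_self)
      finally show ?thesis .
    qed
    have pair: "(\<Sum>m<2 * N. p (m div 2)) = 2 * (\<Sum>n<N. p n)" for N
      by (induction N) simp_all
    have nonneg: "0 \<le> rearr ?fg m * weight_mean m" for m
      using rearr_nonneg[OF fgb] weight_mean_pos[of m] by (intro mult_nonneg_nonneg) auto
    have partial: "(\<Sum>m<N. rearr ?fg m * weight_mean m) \<le> 2 * (\<Sum>n. p n)" for N
    proof -
      have "(\<Sum>m<N. rearr ?fg m * weight_mean m) \<le> (\<Sum>m<2 * N. rearr ?fg m * weight_mean m)"
        using nonneg by (intro sum_mono2) auto
      also have "\<dots> \<le> (\<Sum>m<2 * N. p (m div 2))" using term_le by (intro sum_mono)
      also have "\<dots> \<le> 2 * (\<Sum>n. p n)"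
        unfolding pair using p by (intro mult_left_mono sum_le_suminf) (auto simp: p_def)
      finally show ?thesis .
    qed
    have sum: "summable (\<lambda>m. rearr ?fg m * weight_mean m)"
      using nonneg partial by (rule summableI_nonneg_bounded)
    have "snorm ?L ?fg \<le> (\<Sum>m. rearr ?fg m * weight_mean m)"
      by (rule lorentz_norm_le_sum_means[OF fgb sum])
    also have "\<dots> \<le> 2 * (\<Sum>n. p n)" by (rule suminf_le_const[OF sum partial])
    finally show ?thesis using lorentz_mem_of_summable_means[OF fgb sum] by (simp add: p_def)
  qed
  have bdd_multiplier: "bounded (range g)" if g: "g \<in> elems (multipliers X ?L)" for g
  proof -
    obtain F where F: "F \<in> elems X" "\<And>n. 0 < F n" using X.positive_elem by blast
    have "bounded (range (\<lambda>n. spread s F n * g n))" if "inj s" for s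
      using g X.spread_mem[OF F(1) that] by (simp add: multipliers_def lorentz_def)
    then show ?thesis by (rule bounded_if_spread_products_bounded[OF F(2)])
  qed
  have lower: "\<exists>f'\<in>elems X. snorm X f' = snorm X f \<and> summable (\<lambda>n. \<bar>f n * h g n\<bar>) \<and>
      (\<Sum>n. \<bar>f n * h g n\<bar>) \<le> 2 * C * snorm ?L (\<lambda>n. f' n * g n)"
    if g: "g \<in> elems (multipliers X ?L)" and f: "f \<in> elems X" for f g
  proof -
    have gb: "bounded (range g)" using bdd_multiplier[OF g] .
    obtain s where s: "inj s" "\<And>n. rearr g n / 2 \<le> \<bar>g (s n)\<bar>"
      using rearr_nearly_attained[OF gb] by blast
    let ?f = "spread s f"
    have fX: "?f \<in> elems X" "snorm X ?f = snorm X f" using X.spread_mem X.norm_spread f s(1) by auto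
    define y where "y n = ?f n * g n" for n
    have y: "y \<in> elems ?L" using g fX(1) by (simp add: multipliers_def y_def[abs_def])
    have yb: "bounded (range y)" using y by (simp add: lorentz_def)
    define a where "a n = \<bar>f n\<bar> * (rearr g n / 2)" for n
    have a_le: "\<bar>a n\<bar> \<le> \<bar>y (s n)\<bar>" for n
      using mult_left_mono[OF s(2)[of n] abs_ge_zero[of "f n"]] s(1) rearr_nonneg[OF gb, of n]
      by (simp add: a_def y_def abs_mult)
    have ab: "bounded (range a)"
    proof -
      obtain K where K: "\<And>n. \<bar>y n\<bar> \<le> K" using yb by (auto simp: bounded_iff)
      have "\<bar>a n\<bar> \<le> K" for n using order_trans[OF a_le K] .
      then show ?thesis by (auto simp: bounded_iff)
    qed
    have rearr_a: "rearr a n \<le> rearr y n" for n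
    proof -
      have "rearr a n = rearr (spread s a) n"
        using rearr_cong_equimeasurable[OF equimeasurable_spread[OF s(1)]] by metis
      also have "\<dots> \<le> rearr y n"
        by (intro rearr_mono yb abs_spread_le s(1) a_le)
      finally show ?thesis .
    qed
    have "\<bar>F * (r * w)\<bar> = 2 * (\<bar>\<bar>F\<bar> * (r / 2)\<bar> * w)" if "0 \<le> r" "0 \<le> w" for F r w :: real
      using that by (simp add: abs_mult)
    then have f_a: "\<bar>f n * h g n\<bar> = 2 * (\<bar>a n\<bar> * weight_mean n)" for n
      unfolding a_def h_def using rearr_nonneg[OF gb] weight_mean_pos[THEN less_imp_le] by blast
    have partial: "(\<Sum>n<N. \<bar>f n * h g n\<bar>) \<le> 2 * C * snorm ?L y" for N
    proof -
      have "(\<Sum>n<N. \<bar>f n * h g n\<bar>) = 2 * (\<Sum>n<N. \<bar>a n\<bar> * weight_mean n)"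
        unfolding f_a sum_distrib_left ..
      also have "\<dots> \<le> 2 * (\<Sum>n<N. rearr a n * weight_mean n)"
        using sum_means_le_sum_rearr_means[OF ab] by simp
      also have "\<dots> \<le> 2 * (\<Sum>n<N. rearr y n * weight_mean n)"
        using rearr_a weight_mean_pos by (intro mult_left_mono sum_mono mult_right_mono) (auto simp: less_imp_le)
      also have "\<dots> \<le> 2 * (C * snorm ?L y)"
        using sum_rearr_means_le_lorentz_norm[OF C y] by simp
      finally show ?thesis by simp
    qed
    have sum: "summable (\<lambda>n. \<bar>f n * h g n\<bar>)"
      by (rule summableI_nonneg_bounded[OF _ partial]) simp
    have "(\<Sum>n. \<bar>f n * h g n\<bar>) \<le> 2 * C * snorm ?L y" by (rule suminf_le_const[OF sum partial])
    then show ?thesis using fX sum by (intro bexI[of _ ?f]) (simp_all add: y_def[abs_def])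
  qed
  let ?A = "multipliers X ?L" and ?B = "symmetrization (weighted ?D (\<lambda>t. \<phi> t / t))"
  have B: "g \<in> elems ?B \<longleftrightarrow> bounded (range g) \<and> h g \<in> elems ?D" "snorm ?B g = snorm ?D (h g)" for g
    by (simp_all add: symmetrization_def weighted_def h_def[abs_def])
  have mem: "g \<in> elems ?A \<longleftrightarrow> g \<in> elems ?B" for g
  proof
    assume g: "g \<in> elems ?A"
    then have "h g \<in> elems ?D" unfolding D using lower[OF g] by blast
    then show "g \<in> elems ?B" using bdd_multiplier[OF g] B by blast
  next
    assume "g \<in> elems ?B"
    then show "g \<in> elems ?A" using upper B(1) by (simp add: multipliers_def)
  qed
  moreover have "1 / (2 * C) * snorm ?B g \<le> snorm ?A g \<and> snorm ?A g \<le> 2 * snorm ?B g"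
    if g: "g \<in> elems ?A" for g
  proof -
    have A: "snorm ?A g = (SUP f\<in>?ball. snorm ?L (\<lambda>n. f n * g n))" by (simp add: multipliers_def)
    have gb: "bounded (range g)" "h g \<in> elems ?D" using g mem B by auto
    have ball: "snorm ?L (\<lambda>n. f n * g n) \<le> 2 * snorm ?D (h g)" if f: "f \<in> ?ball" for f
    proof -
      have "snorm ?L (\<lambda>n. f n * g n) \<le> 2 * (\<Sum>n. \<bar>rearr f n * h g n\<bar>)" using upper gb f by blast
      moreover have "(\<Sum>n. \<bar>rearr f n * h g n\<bar>) \<le> snorm ?D (h g)"
        unfolding D using f X.rearr_mem X.norm_rearr
        by (intro cSUP_upper X.koethe_dual_bdd_above gb) auto
      ultimately show ?thesis by linarith
    qed
    have "(\<Sum>n. \<bar>f n * h g n\<bar>) \<le> 2 * C * snorm ?A g" if f: "f \<in> ?ball" for f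
    proof -
      obtain f' where f': "f' \<in> ?ball" "(\<Sum>n. \<bar>f n * h g n\<bar>) \<le> 2 * C * snorm ?L (\<lambda>n. f' n * g n)"
        using lower[OF g, of f] f by force
      have "snorm ?L (\<lambda>n. f' n * g n) \<le> snorm ?A g"
        unfolding A using ball f' by (intro cSUP_upper bdd_aboveI[of _ "2 * snorm ?D (h g)"]) auto
      then have "2 * C * snorm ?L (\<lambda>n. f' n * g n) \<le> 2 * C * snorm ?A g" using C(1) by simp
      then show ?thesis using f'(2) by linarith
    qed
    then have "snorm ?D (h g) \<le> 2 * C * snorm ?A g"
      unfolding D using zero_ball by (intro cSUP_least) auto
    moreover have "snorm ?A g \<le> 2 * snorm ?D (h g)"
      unfolding A using ball zero_ball by (intro cSUP_least) auto
    ultimately show ?thesis using C(1) unfolding B by (simp add: field_simps)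
  qed
  ultimately show ?thesis
    unfolding same_space_def using C(1)
    by (intro conjI exI[of _ "1 / (2 * C)"] exI[of _ 2]) auto
qed

end

section \<open>The multiplier identities\<close>

theorem lemma6p6:
  fixes X Y :: seq_space and \<phi> :: "real \<Rightarrow> real"
  assumes "rearrangement_invariant X" and "fatou_property X"
    and "rearrangement_invariant Y" and "fatou_property Y"
    and "\<And>t. 0 < t \<Longrightarrow> 0 < \<phi> t" and "mono_on {0<..} \<phi>" and "concave_on {0<..} \<phi>"
  shows "(gamma_index \<phi> > 1 \<longrightarrow>
            same_space (multipliers (marcinkiewicz \<phi>) Y)
                       (symmetrization (weighted Y (\<lambda>t. 1 / \<phi> t)))) \<and>
         (delta_index \<phi> < \<infinity> \<longrightarrow>
            same_space (multipliers X (lorentz \<phi>))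
                       (symmetrization (weighted (koethe_dual X) (\<lambda>t. \<phi> t / t))))"
proof -
  interpret pos_mono_concave \<phi> by unfold_locales (use assms in auto)
  show ?thesis
    using multipliers_marcinkiewicz[OF assms(3)] multipliers_lorentz[OF assms(1,2)] by blast
qed

end
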